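(* Let $n\geq 4$ and let $G$ be a strongly connected semi-complete digraph with vertex set $\{1,\ldots,n\}$. Then there are at least two strongly connected induced subgraphs of $G$ with $n-1$ vertices; that is, there exist $i,j\in\{1,\ldots,n\}$ with $i\neq j$ such that $G(i)$ and $G(j)$ are strongly connected.
   Context: A digraph (without loops) is semi-complete if between any two distinct vertices $i,j$ there is a directed edge in at least one direction ($i\to j$ or $j\to i$, possibly both). A digraph is strongly connected if for all pairs of distinct vertices $i,j$ there is a directed path from $i$ to $j$. For a digraph $G$ on $\{1,\ldots,n\}$, $G(i)$ denotes the subgraph of $G$ induced by the vertex set $\{1,\ldots,n\}\setminus\{i\}$. *)

theory Defs
  imports "Graph_Theory.Digraph_Component"
begin

(* The base locale makes the digraph finite, without loops and without parallel arcs;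
   both u -> v and v -> u may be present. *)
locale semicomplete_digraph = digraph +
  assumes semicomplete:
    "\<And>u v. \<lbrakk>u \<in> verts G; v \<in> verts G; u \<noteq> v\<rbrakk> \<Longrightarrow> u \<rightarrow>\<^bsub>G\<^esub> v \<or> v \<rightarrow>\<^bsub>G\<^esub> u"

end

theory Submission
  imports Defs
begin

text \<open>
  If deleting any vertex leaves the digraph strongly connected, there is nothing to do. Otherwise
  fix a cut vertex \<open>v\<close>. The vertices other than \<open>v\<close> split into nonempty sets \<open>A\<close> and \<open>B\<close> with no arc
  from \<open>B\<close> to \<open>A\<close>, so semi-completeness makes every vertex of \<open>A\<close> point to every vertex of \<open>B\<close>.
  Strong connectivity then has only one way to close up: \<open>v\<close> reaches all of \<open>A\<close> inside
  \<open>A \<union> {v}\<close>, and all of \<open>B\<close> reaches \<open>v\<close> inside \<open>B \<union> {v}\<close>. Conversely, any such configuration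
  with \<open>A\<close> and \<open>B\<close> nonempty is strongly connected (\<open>strong_on_double_funnel\<close>).

  So a vertex can be deleted whenever what is left is a configuration of the same shape. A leaf
  of a tree of paths from \<open>B\<close> into \<open>v\<close> can always be removed from \<open>B\<close>
  (\<open>funnels_into_remove\<close>), and dually for \<open>A\<close>; hence one vertex of each is
  deletable if both sets have at least two elements. With four vertices in all, at least one
  of them does; by reversing all arcs let it be \<open>B\<close>, and let \<open>A = {a}\<close>. If
  \<open>a\<close> is not deletable, some \<open>u\<close> in \<open>B\<close> cannot be reached from \<open>v\<close> inside \<open>B \<union> {v}\<close>. Then
  \<open>u\<close> is deletable, because no other vertex of \<open>B\<close> needs \<open>u\<close> in order to reach \<open>v\<close>
  (\<open>funnels_into_avoiding_unreachable\<close>). Moreover \<open>u\<close> points directly to \<open>v\<close>, so a leaf of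
  \<open>B - {u}\<close> is a second deletable vertex.
\<close>

section \<open>Strong connectivity and paths inside a vertex set\<close>

text \<open>
  Working with the bare arc relation makes reversal of all arcs available as \<open>E\<inverse>\<close>, so that
  each argument about paths into a vertex also covers paths out of it.
\<close>

definition strong_on :: "'a rel \<Rightarrow> 'a set \<Rightarrow> bool" where
  "strong_on E S \<longleftrightarrow> (\<forall>x\<in>S. \<forall>y\<in>S. (x, y) \<in> (Restr E S)\<^sup>*)"

text \<open>
  The vertex \<open>v\<close> is added to the set that paths may use, so \<open>X\<close> itself
  need not contain it. With \<open>E\<inverse>\<close> for \<open>E\<close> this says that \<open>v\<close> reaches all of \<open>X\<close>.
\<close>

definition funnels_into :: "'a rel \<Rightarrow> 'a set \<Rightarrow> 'a \<Rightarrow> bool" where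
  "funnels_into E X v \<longleftrightarrow> (\<forall>x\<in>X. (x, v) \<in> (Restr E (insert v X))\<^sup>*)"

lemma Restr_converse: "Restr (E\<inverse>) S = (Restr E S)\<inverse>"
  by blast

lemma strong_on_converse [simp]: "strong_on (E\<inverse>) S = strong_on E S"
  unfolding strong_on_def Restr_converse rtrancl_converse by blast

lemma funnels_into_converse:
  "funnels_into (E\<inverse>) X v \<longleftrightarrow> (\<forall>x\<in>X. (v, x) \<in> (Restr E (insert v X))\<^sup>*)"
  unfolding funnels_into_def Restr_converse rtrancl_converse by blast

lemma rtrancl_Restr_mono:
  assumes "(x, y) \<in> (Restr E S)\<^sup>*" and "S \<subseteq> T"
  shows "(x, y) \<in> (Restr E T)\<^sup>*"
  using assms(1) by (rule rtrancl_mono[THEN subsetD, rotated]) (use assms(2) in blast)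

lemma rtrancl_enters:
  assumes "(x, y) \<in> r\<^sup>*" and "x \<notin> S" and "y \<in> S"
  shows "\<exists>a b. (a, b) \<in> r \<and> a \<notin> S \<and> b \<in> S"
  using assms by (induction rule: converse_rtrancl_induct) blast+

lemma funnels_into_insert:
  assumes "funnels_into E Z v" and "(a, b) \<in> E" and "b \<in> insert v Z"
  shows "funnels_into E (insert a Z) v"
proof -
  have old: "(z, v) \<in> (Restr E (insert v (insert a Z)))\<^sup>*" if "z \<in> insert v Z" for z
  proof (rule rtrancl_Restr_mono)
    show "(z, v) \<in> (Restr E (insert v Z))\<^sup>*"
      using that assms(1) unfolding funnels_into_def by auto
  qed blast
  have "(a, b) \<in> Restr E (insert v (insert a Z))"
    using assms(2,3) by blast
  then have "(a, v) \<in> (Restr E (insert v (insert a Z)))\<^sup>*"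
    using old[OF assms(3)] by (rule converse_rtrancl_into_rtrancl)
  with old show ?thesis
    unfolding funnels_into_def by blast
qed

text \<open>
  The vertex to remove is a leaf of a spanning tree of paths into \<open>v\<close>. The tree need not be
  built: a set that funnels into \<open>v\<close> can be grown inside \<open>X\<close> one vertex at a time, and just before
  it exhausts \<open>X\<close> it lacks exactly one vertex.
\<close>

lemma funnels_into_remove:
  assumes "finite X" and "X \<noteq> {}" and "v \<notin> X" and "funnels_into E X v"
  shows "\<exists>x\<in>X. funnels_into E (X - {x}) v"
proof -
  have grow: "k \<le> card X \<Longrightarrow> \<exists>Z\<subseteq>X. card Z = k \<and> funnels_into E Z v" for k
  proof (induction k)
    case 0
    have "funnels_into E {} v"
      by (simp add: funnels_into_def)
    then show ?case by (intro exI[of _ "{}"]) simp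
  next
    case (Suc k)
    then obtain Z where Z: "Z \<subseteq> X" "card Z = k" "funnels_into E Z v"
      by auto
    with Suc.prems obtain x where x: "x \<in> X" "x \<notin> Z"
      by (metis Suc_n_not_le_n subset_antisym subsetI)
    then have "(x, v) \<in> (Restr E (insert v X))\<^sup>*"
      using assms(4) unfolding funnels_into_def by blast
    moreover have "x \<notin> insert v Z" "v \<in> insert v Z"
      using x assms(3) by auto
    (* x itself may have no arc into Z or to v; a is where a path from x to v enters that set *)
    ultimately obtain a b where ab: "(a, b) \<in> Restr E (insert v X)" "a \<notin> insert v Z" "b \<in> insert v Z"
      using rtrancl_enters[of x v "Restr E (insert v X)" "insert v Z"] by blast
    have "card (insert a Z) = Suc k"
      using ab Z assms(1) by (simp add: finite_subset)
    moreover have "insert a Z \<subseteq> X"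
      using ab Z by blast
    moreover have "funnels_into E (insert a Z) v"
      using funnels_into_insert Z(3) ab by fast
    ultimately show ?case by blast
  qed
  from grow[of "card X - 1"] obtain Z
    where Z: "Z \<subseteq> X" "card Z = card X - 1" "funnels_into E Z v"
    by auto
  have "card X > 0"
    using assms(1,2) by (simp add: card_gt_0_iff)
  then have "card (X - Z) = 1"
    using Z assms(1) by (simp add: card_Diff_subset finite_subset)
  then obtain x where "X - Z = {x}"
    by (meson card_1_singletonE)
  then have "x \<in> X" "Z = X - {x}"
    using Z(1) by blast+
  with Z(3) show ?thesis by blast
qed

lemma strong_on_via_hub:
  assumes "\<And>x. x \<in> S \<Longrightarrow> (x, v) \<in> (Restr E S)\<^sup>*"
    and "\<And>x. x \<in> S \<Longrightarrow> (v, x) \<in> (Restr E S)\<^sup>*"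
  shows "strong_on E S"
  unfolding strong_on_def using assms by (blast intro: rtrancl_trans)

section \<open>Deletable vertices around a cut vertex\<close>

text \<open>
  Everything goes around one cycle: from \<open>v\<close> out into \<open>A\<close>, across to any vertex of \<open>B\<close>, and
  back into \<open>v\<close>. If \<open>A\<close> or \<open>B\<close> were empty, there would be no crossing to close the cycle.
\<close>

lemma strong_on_double_funnel:
  assumes "A \<noteq> {}" and "B \<noteq> {}" and AB: "A \<times> B \<subseteq> E"
    and A: "funnels_into (E\<inverse>) A v" and B: "funnels_into E B v"
  shows "strong_on E (insert v (A \<union> B))" (is "strong_on E ?S")
proof -
  obtain a b where ab: "a \<in> A" "b \<in> B"
    using assms(1,2) by blast
  have to: "(y, v) \<in> (Restr E ?S)\<^sup>*" if "y \<in> B" for y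
    using B that unfolding funnels_into_def by (blast intro: rtrancl_Restr_mono)
  have from_v: "(v, x) \<in> (Restr E ?S)\<^sup>*" if "x \<in> A" for x
    using A that unfolding funnels_into_converse by (blast intro: rtrancl_Restr_mono)
  have arc: "(x, y) \<in> Restr E ?S" if "x \<in> A" "y \<in> B" for x y
    using AB that by blast
  show ?thesis
  proof (rule strong_on_via_hub)
    fix x assume x: "x \<in> ?S"
    then consider "x = v" | "x \<in> A" | "x \<in> B"
      by blast
    then show "(x, v) \<in> (Restr E ?S)\<^sup>*"
      by cases (simp, rule converse_rtrancl_into_rtrancl[OF arc to], use ab to in auto)
    from x consider "x = v" | "x \<in> A" | "x \<in> B"
      by blast
    then show "(v, x) \<in> (Restr E ?S)\<^sup>*"
      by cases (simp, rule from_v, simp, rule rtrancl_into_rtrancl[OF from_v arc], use ab in auto)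
  qed
qed

text \<open>
  Follow a path to \<open>v\<close> until it is about to step from \<open>x\<close> to \<open>u\<close>. Such an \<open>x\<close> is not an
  out-neighbour of \<open>v\<close>, or \<open>u\<close> would be reachable from \<open>v\<close>; so \<open>x\<close> has an arc directly to \<open>v\<close>, which
  replaces the rest of the path.
\<close>

lemma funnels_into_avoiding_unreachable:
  assumes B: "funnels_into E B v"
    and u: "u \<in> B" "(v, u) \<notin> (Restr E (insert v B))\<^sup>*"
    and semi: "\<And>x. x \<in> B \<Longrightarrow> (x, v) \<in> E \<or> (v, x) \<in> E"
  shows "funnels_into E (B - {u}) v"
proof -
  have "x \<noteq> u \<longrightarrow> (x, v) \<in> (Restr E (insert v (B - {u})))\<^sup>*"
    if "(x, v) \<in> (Restr E (insert v B))\<^sup>*" for x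
    using that
  proof (induction rule: converse_rtrancl_induct)
    case base
    then show ?case by blast
  next
    case (step x y)
    show ?case
    proof (cases "y = u")
      case False
      with step show ?thesis
        by (auto intro: converse_rtrancl_into_rtrancl)
    next
      case True
      then have "(v, x) \<notin> Restr E (insert v B)" and "x \<noteq> v"
        using u(2) step.hyps(1) by (meson r_into_rtrancl rtrancl.rtrancl_into_rtrancl)+
      then have "(x, v) \<in> E"
        using semi step.hyps(1) by blast
      then show ?thesis
        using step.hyps(1) by blast
    qed
  qed
  then show ?thesis
    using B unfolding funnels_into_def by blast
qed

text \<open>
  If \<open>A\<close> is a singleton its vertex may be indispensable for reaching \<open>B\<close> from \<open>v\<close>; both deletable
  vertices must then come from \<open>B\<close>, and the vertex \<open>u\<close> of \<open>B\<close> that \<open>v\<close> fails to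
  reach provides them.
\<close>

lemma two_strong_deletions_double_funnel:
  assumes fin: "finite A" "finite B" and "A \<noteq> {}" and B2: "card B \<ge> 2"
    and disj: "v \<notin> A" "v \<notin> B" "A \<inter> B = {}"
    and AB: "A \<times> B \<subseteq> E"
    and A: "funnels_into (E\<inverse>) A v" and B: "funnels_into E B v"
    and semi: "\<And>x. x \<in> B \<Longrightarrow> (x, v) \<in> E \<or> (v, x) \<in> E"
  shows "\<exists>i\<in>insert v (A \<union> B). \<exists>j\<in>insert v (A \<union> B). i \<noteq> j \<and>
    strong_on E (insert v (A \<union> B) - {i}) \<and> strong_on E (insert v (A \<union> B) - {j})"
proof -
  let ?V = "insert v (A \<union> B)"
  have nonempty_diff: "X - {x} \<noteq> {}" if "card X \<ge> 2" for X :: "'a set" and x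
  proof
    assume "X - {x} = {}"
    then have "card X \<le> card {x}"
      by (intro card_mono) auto
    with that show False by simp
  qed
  have delete_B: "strong_on E (?V - {b})" if "b \<in> B" "funnels_into E (B - {b}) v" for b
  proof -
    have "?V - {b} = insert v (A \<union> (B - {b}))"
      using that disj by blast
    then show ?thesis
      using strong_on_double_funnel[of A "B - {b}" E v] that \<open>A \<noteq> {}\<close> nonempty_diff[OF B2] AB A
      by auto
  qed
  have "B \<noteq> {}"
    using B2 by auto
  then obtain b where b: "b \<in> B" "funnels_into E (B - {b}) v"
    using funnels_into_remove fin disj B by metis
  show ?thesis
  proof (cases "card A \<ge> 2")
    case True
    obtain a where a: "a \<in> A" "funnels_into (E\<inverse>) (A - {a}) v"
      using funnels_into_remove fin disj A \<open>A \<noteq> {}\<close> by metis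
    have "?V - {a} = insert v ((A - {a}) \<union> B)"
      using a disj by blast
    then have "strong_on E (?V - {a})"
      using strong_on_double_funnel[of "A - {a}" B E v] a \<open>B \<noteq> {}\<close> nonempty_diff[OF True] AB B
      by auto
    moreover have "a \<noteq> b" "a \<in> ?V" "b \<in> ?V"
      using a b disj by blast+
    ultimately show ?thesis
      using delete_B[OF b] by blast
  next
    case False
    moreover have "card A > 0"
      using fin \<open>A \<noteq> {}\<close> by (simp add: card_gt_0_iff)
    ultimately have "card A = 1"
      by linarith
    then obtain a where a: "A = {a}"
      by (meson card_1_singletonE)
    have V_a: "?V - {a} = insert v B"
      using a disj by blast
    show ?thesis
    proof (cases "strong_on E (insert v B)")
      case True
      moreover have "a \<noteq> b" "a \<in> ?V" "b \<in> ?V"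
        using a b disj by blast+
      ultimately show ?thesis
        using delete_B[OF b] V_a by metis
    next
      case False
      have "\<exists>u\<in>B. (v, u) \<notin> (Restr E (insert v B))\<^sup>*"
      proof (rule ccontr)
        assume "\<not> ?thesis"
        then have "strong_on E (insert v B)"
          using B unfolding funnels_into_def by (intro strong_on_via_hub[of _ v]) auto
        with False show False ..
      qed
      then obtain u where u: "u \<in> B" "(v, u) \<notin> (Restr E (insert v B))\<^sup>*"
        by blast
      have Bu: "funnels_into E (B - {u}) v"
        using funnels_into_avoiding_unreachable[OF B u semi] .
      then obtain r where r: "r \<in> B - {u}" "funnels_into E (B - {u} - {r}) v"
        using funnels_into_remove[of "B - {u}" v E] fin disj nonempty_diff[OF B2] by auto
      (* putting u back after removing r is harmless, since u has an arc to v *)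
      have "(v, u) \<notin> E"
        using u by blast
      then have "(u, v) \<in> E"
        using semi u(1) by blast
      then have "funnels_into E (insert u (B - {u} - {r})) v"
        using funnels_into_insert[OF r(2)] by blast
      moreover have "insert u (B - {u} - {r}) = B - {r}"
        using u r by blast
      ultimately have "strong_on E (?V - {r})"
        using delete_B r by simp
      moreover have "strong_on E (?V - {u})"
        using delete_B u(1) Bu by simp
      moreover have "r \<noteq> u" "r \<in> ?V" "u \<in> ?V"
        using r u by blast+
      ultimately show ?thesis
        by blast
    qed
  qed
qed

section \<open>Two deletable vertices in a strongly connected semi-complete relation\<close>

text \<open>
  A path from \<open>B\<close> to \<open>v\<close> can leave \<open>B\<close> only by entering \<open>v\<close>.
\<close>

lemma funnels_into_of_strong_on:
  assumes "strong_on E V" and "v \<in> V" and "B \<subseteq> V"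
    and "\<And>x y. x \<in> B \<Longrightarrow> y \<in> V - insert v B \<Longrightarrow> (x, y) \<notin> E"
  shows "funnels_into E B v"
proof -
  have "x \<in> B \<longrightarrow> (x, v) \<in> (Restr E (insert v B))\<^sup>*" if "(x, v) \<in> (Restr E V)\<^sup>*" for x
    using that
  proof (induction rule: converse_rtrancl_induct)
    case base
    then show ?case by blast
  next
    case (step x y)
    then consider "x \<notin> B" | "x \<in> B" "y = v" | "x \<in> B" "y \<in> B"
      using assms(4) by blast
    then show ?case
      using step by cases (auto intro: converse_rtrancl_into_rtrancl)
  qed
  then show ?thesis
    using assms(1-3) unfolding strong_on_def funnels_into_def by blast
qed

lemma two_strong_deletions:
  assumes fin: "finite V" and card: "card V \<ge> 4" and strong: "strong_on E V"
    and semi: "\<And>x y. x \<in> V \<Longrightarrow> y \<in> V \<Longrightarrow> x \<noteq> y \<Longrightarrow> (x, y) \<in> E \<or> (y, x) \<in> E"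
  shows "\<exists>i\<in>V. \<exists>j\<in>V. i \<noteq> j \<and> strong_on E (V - {i}) \<and> strong_on E (V - {j})"
proof (cases "\<forall>v\<in>V. strong_on E (V - {v})")
  case True
  have "\<not> card V \<le> 1"
    using card by simp
  then obtain i j where "i \<in> V" "j \<in> V" "i \<noteq> j"
    using fin by (auto simp: card_le_Suc0_iff_eq)
  with True show ?thesis
    by blast
next
  case False
  then obtain v x y where v: "v \<in> V" and xy: "x \<in> V - {v}" "y \<in> V - {v}"
      "(x, y) \<notin> (Restr E (V - {v}))\<^sup>*"
    unfolding strong_on_def by blast
  (* B is closed under arcs that avoid v, and y witnesses that A is nonempty *)
  define B where "B = {z \<in> V - {v}. (x, z) \<in> (Restr E (V - {v}))\<^sup>*}"
  define A where "A = V - {v} - B"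
  have ne: "A \<noteq> {}" "B \<noteq> {}"
    using xy unfolding A_def B_def by blast+
  have disj: "v \<notin> A" "v \<notin> B" "A \<inter> B = {}"
    unfolding A_def B_def by blast+
  have V: "V = insert v (A \<union> B)"
    using v unfolding A_def B_def by blast
  have no_arc: "(s, t) \<notin> E" if "s \<in> B" "t \<in> A" for s t
  proof
    assume "(s, t) \<in> E"
    then have "(s, t) \<in> Restr E (V - {v})"
      using that unfolding A_def B_def by blast
    then have "(x, t) \<in> (Restr E (V - {v}))\<^sup>*"
      using that(1) unfolding B_def by (blast intro: rtrancl_into_rtrancl)
    then show False
      using that(2) unfolding A_def B_def by blast
  qed
  have AB: "A \<times> B \<subseteq> E"
  proof clarify
    fix s t assume "s \<in> A" "t \<in> B"
    then show "(s, t) \<in> E"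
      using semi[of s t] no_arc[of t s] disj V by blast
  qed
  have funB: "funnels_into E B v"
    using strong v by (rule funnels_into_of_strong_on) (use no_arc V in blast)+
  have funA: "funnels_into (E\<inverse>) A v"
    using strong[folded strong_on_converse[of E]] v
    by (rule funnels_into_of_strong_on) (use no_arc V in blast)+
  have fin': "finite A" "finite B"
    using fin V by simp_all
  have "card V = Suc (card A + card B)"
    using V fin' disj by (simp add: card_Un_disjoint)
  (* card A + card B is at least 3; the second case is the first one with all arcs reversed *)
  then consider "card B \<ge> 2" | "card A \<ge> 2"
    using card by linarith
  then show ?thesis
  proof cases
    case 1
    have "(z, v) \<in> E \<or> (v, z) \<in> E" if "z \<in> B" for z
      using semi that v disj V by blast
    then show ?thesis
      using two_strong_deletions_double_funnel[of A B v E] fin' ne 1 disj AB funA funB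
      unfolding V by blast
  next
    case 2
    have "(z, v) \<in> E\<inverse> \<or> (v, z) \<in> E\<inverse>" if "z \<in> A" for z
      using semi that v disj V by blast
    moreover have "B \<times> A \<subseteq> E\<inverse>"
      using AB by blast
    moreover have "insert v (B \<union> A) = V" "B \<inter> A = {}"
      using V disj by blast+
    ultimately show ?thesis
      using two_strong_deletions_double_funnel[of B A v "E\<inverse>"] fin' ne 2 disj funA funB
      by simp
  qed
qed

section \<open>Transfer to induced subgraphs of a digraph\<close>

lemma arcs_ends_induce_subgraph:
  "arcs_ends (G \<restriction> S) = Restr (arcs_ends G) S"
  by (auto simp: arcs_ends_def arc_to_ends_def)

lemma rtrancl_on_eq_rtrancl_Restr:
  "(x, y) \<in> rtrancl_on S r \<longleftrightarrow> x \<in> S \<and> (x, y) \<in> (Restr r S)\<^sup>*"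
proof
  assume "(x, y) \<in> rtrancl_on S r"
  then have "x \<in> S \<and> y \<in> S \<and> (x, y) \<in> (Restr r S)\<^sup>*"
    by (induction rule: rtrancl_on_induct) (auto intro: rtrancl_into_rtrancl)
  then show "x \<in> S \<and> (x, y) \<in> (Restr r S)\<^sup>*"
    by blast
next
  assume *: "x \<in> S \<and> (x, y) \<in> (Restr r S)\<^sup>*"
  then have "(x, y) \<in> (Restr r S)\<^sup>*" by blast
  then show "(x, y) \<in> rtrancl_on S r"
    by induction (use * in \<open>auto intro: rtrancl_on_into_rtrancl_on\<close>)
qed

text \<open>
  The condition \<open>S \<noteq> {}\<close> accounts for the convention that a strongly connected digraph has a
  vertex, whereas \<open>strong_on\<close> holds vacuously on the empty set.
\<close>

lemma strongly_connected_induce_subgraph: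
  "strongly_connected (G \<restriction> S) \<longleftrightarrow> S \<noteq> {} \<and> strong_on (arcs_ends G) S"
proof -
  have "Restr (Restr (arcs_ends G) S) S = Restr (arcs_ends G) S"
    by blast
  then show ?thesis
    unfolding strongly_connected_def strong_on_def reachable_def rtrancl_on_eq_rtrancl_Restr
    by (simp add: arcs_ends_induce_subgraph)
qed

theorem theorem8:
  fixes n :: nat and G :: "(nat, 'b) pre_digraph"
  assumes "n \<ge> 4"
    and "semicomplete_digraph G"
    and "verts G = {1..n}"
    and "strongly_connected G"
  shows "\<exists>i\<in>{1..n}. \<exists>j\<in>{1..n}. i \<noteq> j \<and>
    strongly_connected (G \<restriction> ({1..n} - {i})) \<and>
    strongly_connected (G \<restriction> ({1..n} - {j}))"
proof -
  have "strong_on (arcs_ends G) {1..n}"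
    using assms(3,4)
    unfolding strongly_connected_def strong_on_def reachable_def rtrancl_on_eq_rtrancl_Restr
    by simp
  moreover have "(x, y) \<in> arcs_ends G \<or> (y, x) \<in> arcs_ends G"
    if "x \<in> {1..n}" "y \<in> {1..n}" "x \<noteq> y" for x y
    using semicomplete_digraph.semicomplete[OF assms(2)] assms(3) that by blast
  ultimately obtain i j where ij: "i \<in> {1..n}" "j \<in> {1..n}" "i \<noteq> j"
    and del: "strong_on (arcs_ends G) ({1..n} - {i})" "strong_on (arcs_ends G) ({1..n} - {j})"
    using two_strong_deletions[of "{1..n}" "arcs_ends G"] assms(1) by auto
  moreover have "{1..n} - {i} \<noteq> {}" "{1..n} - {j} \<noteq> {}"
    using ij by blast+
  ultimately show ?thesis
    unfolding strongly_connected_induce_subgraph by blast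
qed

end
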